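(* Let $r \in \mathbb{N}$ with $r \geq 2$, let $p \in (0,1)$, and let $\gamma = p/(1-p)$. Let $N_1$ be the number of samples of an i.i.d. Bernoulli($p$) sequence observed until exactly $r+1$ successes have occurred, and let $N_2$ be the number of samples of a second i.i.d. Bernoulli($p$) sequence, independent of the first, observed until exactly $r-1$ failures have occurred. Define $\hat\gamma = \dfrac{r}{N_1-1}\cdot\dfrac{N_2}{r-1}$ and $N=N_1+N_2$. Then the efficiency of $\hat\gamma$ satisfies $$\eta(\hat\gamma) = \frac{p}{(1-p)^3\,\mathrm{Var}[\hat\gamma]\,\mathrm{E}[N]} > \frac{r-1}{r+1-2p}\left(1+\frac{p(1-p)}{r-1+p+p^2}\right) > \frac{r-1}{r+1}.$$
   Context: A Bernoulli($p$) variable takes the value "success" with probability $p$ and "failure" with probability $1-p$. Sample counts include the last success (respectively failure), so $\Pr[N_1=n]=\binom{n-1}{r}p^{r+1}(1-p)^{n-r-1}$ for $n\ge r+1$, and $\Pr[N_2=n]=\binom{n-1}{r-2}(1-p)^{r-1}p^{n-r+1}$ for $n\ge r-1$; $N_1$ and $N_2$ are independent. For an unbiased estimator $\hat\theta$ of a differentiable function $\theta$ of $p$, based on a random number $N$ of i.i.d. Bernoulli($p$) observations, the efficiency is defined (as the ratio of Wolfowitz's lower bound for $\mathrm{Var}[\hat\theta]\,\mathrm{E}[N]$ to its actual value) by $$\eta(\hat\theta) = \frac{(\mathrm{d}\theta/\mathrm{d}p)^2\,p(1-p)}{\mathrm{Var}[\hat\theta]\,\mathrm{E}[N]}.$$ Here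 $\theta=\gamma$ and $\hat\theta=\hat\gamma$. *)

theory Defs
  imports "HOL-Probability.Probability"
begin

context prob_space
begin

(* True encodes success and False failure. *)
definition iid_bernoulli :: "real \<Rightarrow> (nat \<Rightarrow> 'a \<Rightarrow> bool) \<Rightarrow> bool" where
  "iid_bernoulli p X \<longleftrightarrow>
     indep_vars (\<lambda>_. count_space UNIV) X UNIV \<and>
     (\<forall>i. distr M (count_space UNIV) (X i) = measure_pmf (bernoulli_pmf p))"

definition independent_sequences ::
  "(nat \<Rightarrow> 'a \<Rightarrow> bool) \<Rightarrow> (nat \<Rightarrow> 'a \<Rightarrow> bool) \<Rightarrow> bool" where
  "independent_sequences X Y \<longleftrightarrow>
     indep_var (\<Pi>\<^sub>M i\<in>UNIV. count_space UNIV) (\<lambda>\<omega> i. X i \<omega>)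
               (\<Pi>\<^sub>M i\<in>UNIV. count_space UNIV) (\<lambda>\<omega> i. Y i \<omega>)"

(* Ratio of Wolfowitz's lower bound on Var[est] E[N] to its actual value, for an unbiased
   estimator est of \<theta>(p) based on a random number N of i.i.d. Bernoulli(p) observations. *)
definition efficiency :: "(real \<Rightarrow> real) \<Rightarrow> real \<Rightarrow> ('a \<Rightarrow> real) \<Rightarrow> ('a \<Rightarrow> nat) \<Rightarrow> real" where
  "efficiency \<theta> p est N =
     (deriv \<theta> p)\<^sup>2 * p * (1 - p) / (variance est * expectation (\<lambda>\<omega>. real (N \<omega>)))"

end

(* The count includes the observation at which the k-th occurrence happens.  If fewer than k
   occurrences ever happen (a null event for Bernoulli sequences with 0 < p < 1), the value
   is Inf {} = 0. *)
definition samples_until :: "nat \<Rightarrow> (nat \<Rightarrow> bool) \<Rightarrow> nat" where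
  "samples_until k S = Inf {n. card {i. i < n \<and> S i} = k}"

end

(*
  After shifting by the required number of occurrences, N1 and N2 are negative binomial. Write
  q = 1 - p. The size-bias identity E[(n + J) f(J)] = (n / p) E[f(J')], with J and J' of orders
  n and n + 1, gives all moments exactly except
    E[(r / (N1 - 1))^2] = p E[r / (r + J)]   (J of order r).
  Independence then reduces the efficiency bound to
    E[r / (r + J)] < p (r + p) / (r - 1 + 2 p).
  Up to the factor (q / p)^r, the left-hand side is a power series in q whose derivative is
  r q^(r-1) / p^r. The correspondingly scaled right-hand side has the larger derivative
  r q^(r-1) / p^r + 2 q^(r+1) / (p^(r-1) (r + 1 - 2 q)^2), and both vanish at q = 0.
*)
theory Submission
  imports Defs
begin

section \<open>Stopping counts of a Boolean sequence\<close>

text \<open>The number of hits below \<open>n\<close> is nondecreasing in \<open>n\<close>. It is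
  still \<open>k\<close> at \<open>m\<close>, so no \<open>n \<le> m\<close> reaches
  \<open>Suc k\<close>, and the hit at zero-based index \<open>m\<close> is sample number
  \<open>Suc m\<close>.\<close>

lemma samples_until_eq_Suc:
  assumes "S m" and "card {i. i < m \<and> S i} = k"
  shows "samples_until (Suc k) S = Suc m"
  unfolding samples_until_def
proof (rule cInf_eq_minimum)
  have "{i. i < Suc m \<and> S i} = insert m {i. i < m \<and> S i}"
    using assms(1) by auto
  then show "Suc m \<in> {n. card {i. i < n \<and> S i} = Suc k}"
    using assms(2) by simp
next
  fix n assume n: "n \<in> {n. card {i. i < n \<and> S i} = Suc k}"
  show "Suc m \<le> n"
  proof (rule ccontr)
    assume "\<not> Suc m \<le> n"
    then have "{i. i < n \<and> S i} \<subseteq> {i. i < m \<and> S i}" by auto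
    then have "card {i. i < n \<and> S i} \<le> card {i. i < m \<and> S i}"
      by (intro card_mono) auto
    with n assms(2) show False by simp
  qed
qed

lemma measurable_samples_until [measurable]:
  "samples_until k \<in> (\<Pi>\<^sub>M i\<in>UNIV. count_space UNIV) \<rightarrow>\<^sub>M count_space UNIV"
proof -
  have *: "samples_until k = (\<lambda>S. LEAST n. card {i. i < n \<and> S i} = k)"
    by (auto simp: samples_until_def Inf_nat_def)
  show ?thesis unfolding * by measurable
qed

section \<open>Size-bias identity for the negative binomial distribution\<close>

text \<open>The identity holds termwise: the absorption rule for binomial coefficients turns
  \<open>n + j\<close> times the order-\<open>n\<close> weight at \<open>j\<close> into
  \<open>n / p\<close> times the order-\<open>Suc n\<close> weight. Here \<open>j\<close> counts
  failures and \<open>n + j\<close> all trials.\<close>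

lemma neg_binomial_pmf_size_bias:
  fixes f :: "nat \<Rightarrow> real"
  assumes p: "0 < p" "p \<le> 1" and n: "0 < n"
  shows integrable_neg_binomial_pmf_size_bias:
      "integrable (measure_pmf (neg_binomial_pmf n p)) (\<lambda>j. real (n + j) * f j) \<longleftrightarrow>
       integrable (measure_pmf (neg_binomial_pmf (Suc n) p)) f" (is ?I)
    and expectation_neg_binomial_pmf_size_bias:
      "measure_pmf.expectation (neg_binomial_pmf n p) (\<lambda>j. real (n + j) * f j) =
       real n / p * measure_pmf.expectation (neg_binomial_pmf (Suc n) p) f" (is ?E)
proof -
  have choose: "(n + j) * (j + n - 1 choose j) = n * (j + n choose j)" for j
  proof -
    obtain m where m: "n = Suc m" using n by (cases n) auto
    have "Suc (j + m) * (j + m choose m) = (Suc (j + m) choose Suc m) * Suc m"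
      by (rule Suc_times_binomial_eq)
    moreover have "j + m choose m = j + m choose j" "Suc (j + m) choose Suc m = Suc (j + m) choose j"
      using binomial_symmetric[of m "j + m"] binomial_symmetric[of "Suc m" "Suc (j + m)"] by simp_all
    ultimately show ?thesis using m by (simp add: ac_simps)
  qed
  have eq: "pmf (neg_binomial_pmf n p) j * (real (n + j) * f j) =
      real n / p * (pmf (neg_binomial_pmf (Suc n) p) j * f j)" for j
  proof -
    have "real (n + j) * real (j + n - 1 choose j) = real n * real (j + n choose j)"
      using choose[of j] by (metis of_nat_mult)
    then have "(real (n + j) * real (j + n - 1 choose j)) * (p ^ n * (1 - p) ^ j * f j)
        = (real n * real (j + n choose j)) * (p ^ n * (1 - p) ^ j * f j)"
      by simp
    then show ?thesis using p by (simp add: pmf_neg_binomial field_simps)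
  qed
  have np: "real n / p \<noteq> 0" using p n by simp
  show ?I
    using np
    by (simp add: measure_pmf_eq_density integrable_density pmf_nonneg eq
        del: of_nat_add times_divide_eq_left)
  show ?E
    by (simp add: measure_pmf_eq_density integral_density pmf_nonneg eq del: of_nat_add)
qed

section \<open>Law of the stopping count of a Bernoulli sequence\<close>

context prob_space
begin

text \<open>Allows the count of failures of \<open>Y\<close> to be treated as a count of successes
  with parameter \<open>1 - p\<close>.\<close>

lemma iid_bernoulli_Not:
  assumes "iid_bernoulli p Z" and "0 \<le> p" "p \<le> 1"
  shows "iid_bernoulli (1 - p) (\<lambda>i \<omega>. \<not> Z i \<omega>)"
proof -
  have ind: "indep_vars (\<lambda>_. count_space UNIV) Z UNIV"
    and law: "distr M (count_space UNIV) (Z i) = measure_pmf (bernoulli_pmf p)" for i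
    using assms by (auto simp: iid_bernoulli_def)
  have [measurable]: "Z i \<in> M \<rightarrow>\<^sub>M count_space UNIV" for i
    using ind by (auto simp: indep_vars_def)
  have "indep_vars (\<lambda>_. count_space UNIV) (\<lambda>i \<omega>. \<not> Z i \<omega>) UNIV"
    by (rule indep_vars_compose2[OF ind]) simp
  moreover have "distr M (count_space UNIV) (\<lambda>\<omega>. \<not> Z i \<omega>) = measure_pmf (bernoulli_pmf (1 - p))" for i
  proof -
    have "distr M (count_space UNIV) (\<lambda>\<omega>. \<not> Z i \<omega>) =
        distr (distr M (count_space UNIV) (Z i)) (count_space UNIV) Not"
      by (subst distr_distr) (auto simp: comp_def)
    also have "\<dots> = measure_pmf (map_pmf Not (bernoulli_pmf p))"
      by (simp add: law map_pmf_rep_eq)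
    also have "map_pmf Not (bernoulli_pmf p) = bernoulli_pmf (1 - p)"
    proof (rule pmf_eqI)
      fix b
      have "pmf (map_pmf Not (bernoulli_pmf p)) (Not (\<not> b)) = pmf (bernoulli_pmf p) (\<not> b)"
        by (rule pmf_map_inj') (auto simp: inj_def)
      then show "pmf (map_pmf Not (bernoulli_pmf p)) b = pmf (bernoulli_pmf (1 - p)) b"
        using assms(2,3) by (cases b) auto
    qed
    finally show ?thesis .
  qed
  ultimately show ?thesis by (simp add: iid_bernoulli_def)
qed

lemma prob_iid_bernoulli_pattern:
  assumes "iid_bernoulli p Z" and p: "0 \<le> p" "p \<le> 1"
    and J: "finite J" "J \<noteq> {}" "T \<subseteq> J"
  shows "prob {\<omega> \<in> space M. \<forall>i\<in>J. Z i \<omega> \<longleftrightarrow> i \<in> T} = p ^ card T * (1 - p) ^ card (J - T)"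
proof -
  have ind: "indep_vars (\<lambda>_. count_space UNIV) Z UNIV"
    and law: "distr M (count_space UNIV) (Z i) = measure_pmf (bernoulli_pmf p)" for i
    using assms(1) by (auto simp: iid_bernoulli_def)
  have [measurable]: "Z i \<in> M \<rightarrow>\<^sub>M count_space UNIV" for i
    using ind by (auto simp: indep_vars_def)
  have one: "prob (Z i -` {b} \<inter> space M) = (if b then p else 1 - p)" for i b
  proof -
    have "prob (Z i -` {b} \<inter> space M) = measure (distr M (count_space UNIV) (Z i)) {b}"
      by (simp add: measure_distr)
    also have "\<dots> = pmf (bernoulli_pmf p) b" by (simp add: law pmf.rep_eq)
    finally show ?thesis using p by simp
  qed
  have "{\<omega> \<in> space M. \<forall>i\<in>J. Z i \<omega> \<longleftrightarrow> i \<in> T} = (\<Inter>i\<in>J. Z i -` {i \<in> T} \<inter> space M)"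
    using J by auto
  also have "prob \<dots> = (\<Prod>i\<in>J. prob (Z i -` {i \<in> T} \<inter> space M))"
    by (rule indep_varsD[OF ind]) (use J in auto)
  also have "\<dots> = (\<Prod>i\<in>J. if i \<in> T then p else 1 - p)"
    by (simp only: one)
  also have "\<dots> = p ^ card T * (1 - p) ^ card (J - T)"
  proof -
    have "J \<inter> {i. i \<in> T} = T" "J \<inter> - {i. i \<in> T} = J - T" using J by auto
    then show ?thesis using J by (simp add: prod.If_cases)
  qed
  finally show ?thesis .
qed

text \<open>The event splits according to the set \<open>T\<close> of the \<open>k\<close> success
  positions below \<open>m\<close>. Each \<open>T\<close> fixes the whole pattern on
  \<open>{..m}\<close>, and all these patterns are equally likely. If \<open>k > m\<close> there is
  no such \<open>T\<close> and the binomial coefficient is 0, so the truncated \<open>m - k\<close>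
  does no harm.\<close>

lemma prob_iid_bernoulli_success_after:
  assumes Z: "iid_bernoulli p Z" and p: "0 \<le> p" "p \<le> 1"
  shows "prob {\<omega> \<in> space M. Z m \<omega> \<and> card {i. i < m \<and> Z i \<omega>} = k} =
    real (m choose k) * p ^ Suc k * (1 - p) ^ (m - k)"
proof -
  have [measurable]: "Z i \<in> M \<rightarrow>\<^sub>M count_space UNIV" for i
    using Z by (auto simp: iid_bernoulli_def indep_vars_def)
  define A where "A = {T. T \<subseteq> {..<m} \<and> card T = k}"
  define E where "E T = {\<omega> \<in> space M. \<forall>i\<in>{..m}. Z i \<omega> \<longleftrightarrow> i \<in> insert m T}" for T
  have "finite A" unfolding A_def by auto
  have "{\<omega> \<in> space M. Z m \<omega> \<and> card {i. i < m \<and> Z i \<omega>} = k} = (\<Union>T\<in>A. E T)"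
  proof (intro equalityI subsetI)
    fix \<omega> assume \<omega>: "\<omega> \<in> {\<omega> \<in> space M. Z m \<omega> \<and> card {i. i < m \<and> Z i \<omega>} = k}"
    then have "{i. i < m \<and> Z i \<omega>} \<in> A" "\<omega> \<in> E {i. i < m \<and> Z i \<omega>}"
      by (auto simp: A_def E_def)
    then show "\<omega> \<in> (\<Union>T\<in>A. E T)" by blast
  next
    fix \<omega> assume "\<omega> \<in> (\<Union>T\<in>A. E T)"
    then obtain T where T: "T \<in> A" "\<omega> \<in> E T" by blast
    then have "{i. i < m \<and> Z i \<omega>} = T" by (force simp: A_def E_def)
    with T show "\<omega> \<in> {\<omega> \<in> space M. Z m \<omega> \<and> card {i. i < m \<and> Z i \<omega>} = k}"
      by (auto simp: A_def E_def)
  qed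
  also have "prob (\<Union>T\<in>A. E T) = (\<Sum>T\<in>A. prob (E T))"
  proof (rule finite_measure_finite_Union)
    show "E ` A \<subseteq> events" unfolding E_def by (intro image_subsetI) measurable
    show "disjoint_family_on E A"
      unfolding disjoint_family_on_def
    proof (intro ballI impI)
      \<comment> \<open>Two different sets of positions disagree at some \<open>i < m\<close>, and
        the two patterns contradict each other there.\<close>
      fix S T assume ST: "S \<in> A" "T \<in> A" "S \<noteq> T"
      then obtain i where i: "i < m" "i \<in> S \<longleftrightarrow> i \<notin> T" by (auto simp: A_def)
      then show "E S \<inter> E T = {}" by (force simp: E_def)
    qed
  qed fact
  also have "\<dots> = (\<Sum>T\<in>A. p ^ Suc k * (1 - p) ^ (m - k))"
  proof (rule sum.cong)
    fix T assume T: "T \<in> A"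
    then have "finite T" "m \<notin> T" "card T = k" by (auto simp: A_def intro: finite_subset)
    moreover have "{..m} - insert m T = {..<m} - T" by auto
    moreover have "card ({..<m} - T) = m - k"
      using T \<open>finite T\<close> by (subst card_Diff_subset) (auto simp: A_def)
    moreover have "prob (E T) = p ^ card (insert m T) * (1 - p) ^ card ({..m} - insert m T)"
      unfolding E_def by (rule prob_iid_bernoulli_pattern[OF Z p]) (use T in \<open>auto simp: A_def\<close>)
    ultimately show "prob (E T) = p ^ Suc k * (1 - p) ^ (m - k)" by simp
  qed simp
  also have "\<dots> = real (card A) * (p ^ Suc k * (1 - p) ^ (m - k))" by simp
  also have "card A = m choose k" unfolding A_def by (simp add: n_subsets)
  finally show ?thesis by (simp add: mult.assoc)
qed

lemma samples_until_measurable_iid_bernoulli: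
  assumes "iid_bernoulli p Z"
  shows "(\<lambda>\<omega>. samples_until k (\<lambda>i. Z i \<omega>)) \<in> M \<rightarrow>\<^sub>M count_space UNIV"
  by (rule measurable_compose[OF _ measurable_samples_until], rule measurable_PiM_single')
    (use assms in \<open>auto simp: iid_bernoulli_def indep_vars_def\<close>)

text \<open>\<open>neg_binomial_pmf\<close> counts only the failures; adding the
  \<open>Suc k\<close> successes gives the number of samples.\<close>

lemma distr_samples_until:
  assumes Z: "iid_bernoulli p Z" and p: "0 < p" "p \<le> 1"
  shows "distr M (count_space UNIV) (\<lambda>\<omega>. samples_until (Suc k) (\<lambda>i. Z i \<omega>)) =
    measure_pmf (map_pmf (\<lambda>j. j + Suc k) (neg_binomial_pmf (Suc k) p))" (is "?D = measure_pmf ?\<mu>")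
proof (rule measure_eqI_countable)
  note [measurable] = samples_until_measurable_iid_bernoulli[OF Z]
  interpret D: prob_space ?D by (rule prob_space_distr) simp
  text \<open>
    On the null event of fewer than \<open>Suc k\<close> successes, \<open>Inf {}\<close> is an unspecified number, so only
    \<open>\<le>\<close> is immediate pointwise; equality follows because both sides sum to 1.
  \<close>
  have ge: "pmf ?\<mu> n \<le> measure ?D {n}" for n
  proof (cases "n < Suc k")
    case True
    then have "n \<notin> set_pmf ?\<mu>" by auto
    then have "pmf ?\<mu> n = 0" by (rule pmf_eq_0_set_pmf[THEN iffD2])
    then show ?thesis by simp
  next
    case False
    then obtain j where n: "n = j + Suc k"
      by (metis add.commute le_Suc_ex not_less)
    have "pmf ?\<mu> n = pmf (neg_binomial_pmf (Suc k) p) j"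
      unfolding n by (rule pmf_map_inj') (auto simp: inj_def)
    also have "\<dots> = real (j + k choose j) * p ^ Suc k * (1 - p) ^ j"
      using p by (simp add: pmf_neg_binomial)
    also have "j + k choose j = j + k choose k"
      using binomial_symmetric[of j "j + k"] by simp
    also have "real (j + k choose k) * p ^ Suc k * (1 - p) ^ j =
        prob {\<omega> \<in> space M. Z (j + k) \<omega> \<and> card {i. i < j + k \<and> Z i \<omega>} = k}"
      using prob_iid_bernoulli_success_after[OF Z, of "j + k" k] p by simp
    \<comment> \<open>With indices starting at 0, the last success of a run of
      \<open>n = j + Suc k\<close> samples sits at index \<open>j + k\<close>.\<close>
    also have "\<dots> \<le> prob ((\<lambda>\<omega>. samples_until (Suc k) (\<lambda>i. Z i \<omega>)) -` {n} \<inter> space M)"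
      by (rule finite_measure_mono) (auto simp: n samples_until_eq_Suc)
    also have "\<dots> = measure ?D {n}" by (simp add: measure_distr)
    finally show ?thesis .
  qed
  have "(\<lambda>n. measure ?D {n}) sums measure ?D (\<Union>n. {n})"
    by (rule D.finite_measure_UNION) (auto simp: disjoint_family_on_def)
  moreover have "(\<lambda>n. measure ?\<mu> {n}) sums measure ?\<mu> (\<Union>n. {n})"
    by (rule measure_pmf.finite_measure_UNION) (auto simp: disjoint_family_on_def)
  ultimately have s: "(\<lambda>n. measure ?D {n} - pmf ?\<mu> n) sums 0"
    using D.prob_space by (auto simp: pmf.rep_eq dest: sums_diff)
  have "measure ?D {n} - pmf ?\<mu> n = 0" for n
    using suminf_eq_zero_iff[OF sums_summable[OF s]] ge s by (simp add: sums_iff)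
  then show "emeasure ?D {n} = emeasure ?\<mu> {n}" for n
    by (simp add: D.emeasure_eq_measure measure_pmf.emeasure_eq_measure pmf.rep_eq)
qed auto

end

section \<open>Upper bound for the inverse moment of the number of trials\<close>

text \<open>This is the total mass 1 of the negative binomial law of order \<open>Suc k\<close> with
  success probability \<open>1 - t\<close>, rescaled and shifted by \<open>k\<close>; the terms with
  \<open>m < k\<close> vanish.\<close>

lemma sums_binomial_powser:
  assumes t: "0 \<le> t" "t < (1::real)"
  shows "(\<lambda>m. real (m choose k) * t ^ m) sums (t ^ k / (1 - t) ^ Suc k)"
proof -
  let ?\<mu> = "neg_binomial_pmf (Suc k) (1 - t)"
  have pmf: "pmf ?\<mu> j = real (j + k choose k) * (1 - t) ^ Suc k * t ^ j" for j
    using t binomial_symmetric[of j "j + k"] by (subst pmf_neg_binomial) auto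
  have "(\<lambda>j. measure ?\<mu> {j}) sums measure ?\<mu> (\<Union>j. {j})"
    by (rule measure_pmf.finite_measure_UNION) (auto simp: disjoint_family_on_def)
  then have "(\<lambda>j. pmf ?\<mu> j) sums 1" by (simp add: pmf.rep_eq)
  then have "(\<lambda>j. t ^ k / (1 - t) ^ Suc k * pmf ?\<mu> j) sums (t ^ k / (1 - t) ^ Suc k * 1)"
    by (rule sums_mult)
  also have "(\<lambda>j. t ^ k / (1 - t) ^ Suc k * pmf ?\<mu> j) = (\<lambda>j. real (j + k choose k) * t ^ (j + k))"
    using t by (simp add: pmf fun_eq_iff power_add)
  finally show ?thesis
    by (subst (asm) sums_zero_iff_shift) auto
qed

text \<open>With \<open>n = Suc k\<close> and \<open>p = 1 - t\<close>, \<open>G\<close> is the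
  bound \<open>p * (n + p) / (n - 1 + 2 * p)\<close> scaled by \<open>(t / (1 - t)) ^ n\<close>. The
  derivative is split so that its first summand is the derivative of the series it is compared with
  and the second is the surplus.\<close>

lemma DERIV_negbin_comparison:
  fixes t :: real and k :: nat
  defines "G \<equiv> \<lambda>t. (t / (1 - t)) ^ Suc k * ((real k + 2 - t) * (1 - t) / (real k + 2 - 2 * t))"
  assumes t: "t < 1"
  shows "(G has_real_derivative
    real (Suc k) * (t ^ k / (1 - t) ^ Suc k) + 2 * t\<^sup>2 * (t / (1 - t)) ^ k / (real k + 2 - 2 * t)\<^sup>2) (at t)"
proof -
  define w where "w = real k + 2 - 2 * t"
  have w: "w > 0" and u: "1 - t > 0" using t by (auto simp: w_def)
  have 1: "((\<lambda>t. t / (1 - t)) has_real_derivative 1 / (1 - t)\<^sup>2) (at t)"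
    using u by (auto intro!: derivative_eq_intros simp: power2_eq_square)
  have 2: "((\<lambda>t. (real k + 2 - t) * (1 - t) / (real k + 2 - 2 * t)) has_real_derivative
      ((2 * t - real k - 3) * w + 2 * ((real k + 2 - t) * (1 - t))) / w\<^sup>2) (at t)"
    using w unfolding w_def
    by (auto intro!: derivative_eq_intros simp: power2_eq_square algebra_simps)
  have "(G has_real_derivative
      real (Suc k) * (t / (1 - t)) ^ k * (1 / (1 - t)\<^sup>2) * ((real k + 2 - t) * (1 - t) / w) +
      (t / (1 - t)) ^ Suc k * (((2 * t - real k - 3) * w + 2 * ((real k + 2 - t) * (1 - t))) / w\<^sup>2)) (at t)"
    unfolding G_def
    by (rule DERIV_cong[OF DERIV_mult[OF DERIV_power[OF 1] 2]]) (simp add: w_def mult_ac)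
  also have "real (Suc k) * (t / (1 - t)) ^ k * (1 / (1 - t)\<^sup>2) * ((real k + 2 - t) * (1 - t) / w) +
      (t / (1 - t)) ^ Suc k * (((2 * t - real k - 3) * w + 2 * ((real k + 2 - t) * (1 - t))) / w\<^sup>2) =
      real (Suc k) * (t ^ k / (1 - t) ^ Suc k) + 2 * t\<^sup>2 * (t / (1 - t)) ^ k / w\<^sup>2"
  proof -
    define x where "x = (t / (1 - t)) ^ k"
    have x: "t ^ k / (1 - t) ^ Suc k = x / (1 - t)" "(t / (1 - t)) ^ Suc k = x * t / (1 - t)"
      by (simp_all add: x_def power_divide mult.commute)
    \<comment> \<open>Over the common denominator \<open>(1 - t) * w\<^sup>2\<close>, and up to the
      factor \<open>x\<close>, the two forms of the derivative have these numerators.\<close>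
    have "real (Suc k) * (real k + 2 - t) * w +
        t * ((2 * t - real k - 3) * w + 2 * ((real k + 2 - t) * (1 - t))) =
        real (Suc k) * w\<^sup>2 + 2 * t\<^sup>2 * (1 - t)"
      by (simp add: w_def power2_eq_square algebra_simps)
    then have "x * (real (Suc k) * (real k + 2 - t) * w +
        t * ((2 * t - real k - 3) * w + 2 * ((real k + 2 - t) * (1 - t)))) / ((1 - t) * w\<^sup>2) =
        x * (real (Suc k) * w\<^sup>2 + 2 * t\<^sup>2 * (1 - t)) / ((1 - t) * w\<^sup>2)"
      by simp
    moreover have "x * (real (Suc k) * w\<^sup>2 + 2 * t\<^sup>2 * (1 - t)) / ((1 - t) * w\<^sup>2) =
        real (Suc k) * (x / (1 - t)) + 2 * t\<^sup>2 * x / w\<^sup>2"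
      using w u by (simp add: field_simps)
    moreover have "x * (a * b * w + t * c) / ((1 - t) * w\<^sup>2) =
        a * x * (1 / (1 - t)\<^sup>2) * (b * (1 - t) / w) + x * t / (1 - t) * (c / w\<^sup>2)" for a b c
      using w u by (simp add: divide_simps power2_eq_square) (simp add: algebra_simps)
    ultimately show ?thesis unfolding x by (simp only: x_def)
  qed
  finally show ?thesis by (simp add: w_def)
qed

lemma expectation_neg_binomial_pmf_inverse_less:
  assumes p: "0 < p" "p < 1" and n: "0 < n"
  shows "measure_pmf.expectation (neg_binomial_pmf n p) (\<lambda>j. real n / real (n + j)) <
    p * (real n + p) / (real n - 1 + 2 * p)"
proof -
  obtain k where k: "n = Suc k" using n by (cases n) auto
  define q where "q = 1 - p"
  have q: "0 < q" "q < 1" "p = 1 - q" using p by (auto simp: q_def)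
  let ?\<mu> = "neg_binomial_pmf n p"
  \<comment> \<open>Coefficients of the series in \<open>q\<close> that equals the expectation up to
    the factor \<open>(p / q) ^ n\<close>; the index \<open>m\<close> is the number of trials
    \<open>n + j\<close>.\<close>
  define c where "c m = real n / real m * real (m - 1 choose k)" for m
  \<comment> \<open>For \<open>m = 0\<close> the value is 0 because division by zero gives 0; this
    matters for \<open>k = 0\<close>, where the binomial coefficient is 1.\<close>
  have c0: "c m = 0" if "m < n" for m
    using that by (cases m) (auto simp: c_def k)
  \<comment> \<open>Differentiation cancels the denominator \<open>m\<close> and leaves the binomial
    series, which has a closed form.\<close>
  have diffs_c: "diffs c m = real n * real (m choose k)" for m
    by (simp add: diffs_def c_def)
  \<comment> \<open>Domination by the binomial series: for \<open>m > 0\<close>,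
    \<open>n / m\<close> is at most \<open>n\<close>, and \<open>m - 1 choose k\<close> is at most
    \<open>m choose k\<close>.\<close>
  have summ: "summable (\<lambda>m. c m * z ^ m)" if "norm z < 1" for z :: real
  proof (rule summable_comparison_test')
    show "summable (\<lambda>m. real n * (real (m choose k) * \<bar>z\<bar> ^ m))"
      using that by (intro summable_mult sums_summable[OF sums_binomial_powser]) auto
    fix m :: nat
    have "m - 1 choose k \<le> m choose k" by (rule binomial_right_mono) simp
    then have "real n / real m * real (m - 1 choose k) \<le> real n * real (m choose k)"
      using divide_left_mono[of 1 "real m" "real n"]
      by (cases "m = 0") (auto intro!: mult_mono simp del: times_divide_eq_left)
    then have "c m * \<bar>z\<bar> ^ m \<le> real n * real (m choose k) * \<bar>z\<bar> ^ m"
      unfolding c_def by (rule mult_right_mono) simp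
    moreover have "\<bar>c m\<bar> = c m" by (simp add: c_def)
    ultimately show "norm (c m * z ^ m) \<le> real n * (real (m choose k) * \<bar>z\<bar> ^ m)"
      by (simp add: abs_mult power_abs)
  qed
  define F where "F z = (\<Sum>m. c m * z ^ m)" for z
  define G where "G t = (t / (1 - t)) ^ Suc k * ((real k + 2 - t) * (1 - t) / (real k + 2 - 2 * t))" for t
  have F': "(F has_real_derivative real (Suc k) * (t ^ k / (1 - t) ^ Suc k)) (at t)"
    if "0 \<le> t" "t < 1" for t
  proof -
    have "(F has_real_derivative (\<Sum>m. diffs c m * t ^ m)) (at t)"
      unfolding F_def by (rule termdiffs_strong'[where K = 1]) (use that summ in auto)
    moreover have "(\<Sum>m. diffs c m * t ^ m) = real (Suc k) * (t ^ k / (1 - t) ^ Suc k)"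
      using sums_mult[OF sums_binomial_powser[OF that, of k], of "real n"]
      by (simp add: diffs_c sums_iff k mult.assoc)
    ultimately show ?thesis by simp
  qed
  have D': "((\<lambda>t. G t - F t) has_real_derivative
      2 * t\<^sup>2 * (t / (1 - t)) ^ k / (real k + 2 - 2 * t)\<^sup>2) (at t)" if "0 \<le> t" "t < 1" for t
    using DERIV_diff[OF DERIV_negbin_comparison[OF that(2), of k] F'[OF that]]
    by (simp add: G_def[abs_def])
  \<comment> \<open>The derivative of the difference vanishes at 0 and is positive on the open
    interval, which together with continuity suffices for a strict increase.\<close>
  have "G 0 - F 0 < G q - F q"
  proof (rule DERIV_pos_imp_increasing_open[OF q(1)])
    fix t assume t: "0 < t" "t < q"
    then have "2 * t\<^sup>2 * (t / (1 - t)) ^ k / (real k + 2 - 2 * t)\<^sup>2 > 0"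
      using q by (intro divide_pos_pos mult_pos_pos zero_less_power) auto
    then show "\<exists>y. ((\<lambda>t. G t - F t) has_real_derivative y) (at t) \<and> y > 0"
      using D'[of t] t q by auto
  next
    show "continuous_on {0..q} (\<lambda>t. G t - F t)"
      by (rule DERIV_continuous_on[OF DERIV_subset[OF D']]) (use q in auto)
  qed
  moreover have "G 0 = 0" by (simp add: G_def)
  moreover have "F 0 = 0" using c0[of 0] n by (simp add: F_def)
  ultimately have FG: "F q < G q" by simp
  have "measure_pmf.expectation ?\<mu> (\<lambda>j. real n / real (n + j)) =
      (\<integral>j. pmf ?\<mu> j * (real n / real (n + j)) \<partial>count_space UNIV)"
    by (simp add: measure_pmf_eq_density integral_density pmf_nonneg)
  also have "\<dots> = (\<Sum>j. pmf ?\<mu> j * (real n / real (n + j)))"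
  proof (rule integral_count_space_nat)
    have "integrable (measure_pmf ?\<mu>) (\<lambda>j. real n / real (n + j))"
      by (rule measure_pmf.integrable_const_bound[where B = 1]) (use n in auto)
    then show "integrable (count_space UNIV) (\<lambda>j. pmf ?\<mu> j * (real n / real (n + j)))"
      by (simp add: measure_pmf_eq_density integrable_density pmf_nonneg)
  qed
  \<comment> \<open>Writing \<open>p ^ n * q ^ j\<close> as \<open>(p / q) ^ n * q ^ (j + n)\<close>
    makes the exponent the number of trials.\<close>
  also have "\<dots> = (\<Sum>j. (p / q) ^ n * (c (j + n) * q ^ (j + n)))"
  proof (rule suminf_cong)
    fix j
    have "j + k choose j = j + k choose k"
      using binomial_symmetric[of j "j + k"] by simp
    then show "pmf ?\<mu> j * (real n / real (n + j)) = (p / q) ^ n * (c (j + n) * q ^ (j + n))"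
      using p q(1) n by (simp add: pmf_neg_binomial c_def k q_def power_add power_divide add_ac)
  qed
  also have "\<dots> = (p / q) ^ n * F q"
  proof -
    have "(\<lambda>m. c m * q ^ m) sums F q"
      unfolding F_def using summ[of q] q by (simp add: summable_sums)
    then have "(\<lambda>j. c (j + n) * q ^ (j + n)) sums F q"
      by (subst sums_zero_iff_shift) (auto simp: c0)
    from sums_mult[OF this] show ?thesis by (simp add: sums_iff)
  qed
  also have "\<dots> < (p / q) ^ n * G q"
    using FG p q by (intro mult_strict_left_mono) auto
  also have "\<dots> = p * (real n + p) / (real n - 1 + 2 * p)"
  proof -
    \<comment> \<open>The prefactor of the expectation is the exact inverse of the scaling built
      into \<open>G\<close>.\<close>
    have "(p / q) ^ n * (q / (1 - q)) ^ Suc k = 1"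
      using p q(1) unfolding k q(3)[symmetric] power_mult_distrib[symmetric] by simp
    then have "(p / q) ^ n * G q = (real k + 2 - q) * (1 - q) / (real k + 2 - 2 * q)"
      unfolding G_def mult.assoc[symmetric] by simp
    then show ?thesis by (simp add: k q_def algebra_simps)
  qed
  finally show ?thesis .
qed

section \<open>Moments of the trial count and of its shifted inverse\<close>

lemma expectation_neg_binomial_pmf_trials:
  assumes p: "0 < p" "p \<le> 1" and n: "0 < n"
  shows integrable_neg_binomial_pmf_trials:
      "integrable (measure_pmf (neg_binomial_pmf n p)) (\<lambda>j. real (n + j))" (is ?I)
    and "measure_pmf.expectation (neg_binomial_pmf n p) (\<lambda>j. real (n + j)) = real n / p" (is ?E)
proof -
  show ?I
    using integrable_neg_binomial_pmf_size_bias[OF assms, of "\<lambda>_. 1"] by simp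
  show ?E
    using expectation_neg_binomial_pmf_size_bias[OF assms, of "\<lambda>_. 1"] by simp
qed

text \<open>Size bias removes one factor \<open>n + j\<close> and raises the order to
  \<open>Suc n\<close>. There \<open>n + j\<close> is one less than the number of trials, so its
  mean is \<open>(n + 1) / p - 1\<close>.\<close>

lemma expectation_neg_binomial_pmf_trials_square:
  assumes p: "0 < p" "p \<le> 1" and n: "0 < n"
  shows integrable_neg_binomial_pmf_trials_square:
      "integrable (measure_pmf (neg_binomial_pmf n p)) (\<lambda>j. (real (n + j))\<^sup>2)" (is ?I)
    and "measure_pmf.expectation (neg_binomial_pmf n p) (\<lambda>j. (real (n + j))\<^sup>2) =
      real n * (real n + 1 - p) / p\<^sup>2" (is ?E)
proof -
  have shift: "(\<lambda>j. real (n + j)) = (\<lambda>j. real (Suc n + j) - 1)" by simp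
  have int: "integrable (measure_pmf (neg_binomial_pmf (Suc n) p)) (\<lambda>j. real (Suc n + j))"
    by (rule integrable_neg_binomial_pmf_trials) (use p in auto)
  have "integrable (measure_pmf (neg_binomial_pmf (Suc n) p)) (\<lambda>j. real (n + j))"
    unfolding shift by (intro Bochner_Integration.integrable_diff int) simp
  then show ?I
    using integrable_neg_binomial_pmf_size_bias[OF assms, of "\<lambda>j. real (n + j)"]
    unfolding power2_eq_square by simp
  have E: "measure_pmf.expectation (neg_binomial_pmf (Suc n) p) (\<lambda>j. real (n + j)) = real (Suc n) / p - 1"
    using expectation_neg_binomial_pmf_trials[of p "Suc n"] p
    unfolding shift by (subst Bochner_Integration.integral_diff[OF int]) auto
  show ?E
    unfolding power2_eq_square expectation_neg_binomial_pmf_size_bias[OF assms] E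
    using p by (simp add: field_simps)
qed

text \<open>Unbiasedness of Haldane's estimator of \<open>p\<close>: for order \<open>Suc n\<close>,
  \<open>n + j\<close> is the number of trials minus one. On the order-\<open>n\<close> side of the
  size-bias identity the integrand becomes the constant \<open>n\<close>.\<close>

lemma expectation_neg_binomial_pmf_haldane:
  assumes p: "0 < p" "p \<le> 1" and n: "0 < n"
  shows "measure_pmf.expectation (neg_binomial_pmf (Suc n) p) (\<lambda>j. real n / real (n + j)) = p"
proof -
  have "(\<lambda>j. real (n + j) * (real n / real (n + j))) = (\<lambda>j. real n)"
    using n by (auto simp: fun_eq_iff)
  then show ?thesis
    using expectation_neg_binomial_pmf_size_bias[OF assms, of "\<lambda>j. real n / real (n + j)"] p n
    by (simp add: field_simps)
qed

text \<open>Size bias cancels only one of the two inverse factors, leaving \<open>p\<close> times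
  the inverse moment of order \<open>n\<close>, for which the series comparison gives the
  bound.\<close>

lemma expectation_neg_binomial_pmf_haldane_square_less:
  assumes p: "0 < p" "p < 1" and n: "0 < n"
  shows "measure_pmf.expectation (neg_binomial_pmf (Suc n) p) (\<lambda>j. (real n / real (n + j))\<^sup>2) <
    p\<^sup>2 * (real n + p) / (real n - 1 + 2 * p)"
proof -
  let ?E = "measure_pmf.expectation (neg_binomial_pmf (Suc n) p) (\<lambda>j. (real n / real (n + j))\<^sup>2)"
  have "(\<lambda>j. real (n + j) * (real n / real (n + j))\<^sup>2) = (\<lambda>j. real n * (real n / real (n + j)))"
    using n by (auto simp: fun_eq_iff power2_eq_square)
  then have "real n * measure_pmf.expectation (neg_binomial_pmf n p) (\<lambda>j. real n / real (n + j)) =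
      real n / p * ?E"
    using expectation_neg_binomial_pmf_size_bias[of p n "\<lambda>j. (real n / real (n + j))\<^sup>2"] p n
    by (simp del: of_nat_add times_divide_eq_right)
  then have "?E = p * measure_pmf.expectation (neg_binomial_pmf n p) (\<lambda>j. real n / real (n + j))"
    using p n by (simp add: field_simps)
  also have "\<dots> < p * (p * (real n + p) / (real n - 1 + 2 * p))"
    using expectation_neg_binomial_pmf_inverse_less[OF assms] p(1) by (rule mult_strict_left_mono)
  finally show ?thesis by (simp add: power2_eq_square)
qed

section \<open>Transfer of moments to the sample space and variance of a product\<close>

context prob_space
begin

lemma samples_until_transfer:
  fixes g :: "nat \<Rightarrow> real"
  assumes Z: "iid_bernoulli p Z" and p: "0 < p" "p \<le> 1" and k: "0 < k"
  shows integrable_samples_until_iff: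
      "integrable M (\<lambda>\<omega>. g (samples_until k (\<lambda>i. Z i \<omega>))) \<longleftrightarrow>
       integrable (measure_pmf (neg_binomial_pmf k p)) (\<lambda>j. g (k + j))" (is ?I)
    and expectation_samples_until:
      "expectation (\<lambda>\<omega>. g (samples_until k (\<lambda>i. Z i \<omega>))) =
       measure_pmf.expectation (neg_binomial_pmf k p) (\<lambda>j. g (k + j))" (is ?E)
proof -
  note [measurable] = samples_until_measurable_iid_bernoulli[OF Z]
  have D: "distr M (count_space UNIV) (\<lambda>\<omega>. samples_until k (\<lambda>i. Z i \<omega>)) =
      measure_pmf (map_pmf (\<lambda>j. k + j) (neg_binomial_pmf k p))"
    using distr_samples_until[OF Z p, of "k - 1"] k by (simp add: add.commute)
  have "integrable M (\<lambda>\<omega>. g (samples_until k (\<lambda>i. Z i \<omega>))) \<longleftrightarrow>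
      integrable (distr M (count_space UNIV) (\<lambda>\<omega>. samples_until k (\<lambda>i. Z i \<omega>))) g"
    by (rule integrable_distr_eq[symmetric]) auto
  then show ?I by (simp add: D integrable_map_pmf_eq)
  have "expectation (\<lambda>\<omega>. g (samples_until k (\<lambda>i. Z i \<omega>))) =
      integral\<^sup>L (distr M (count_space UNIV) (\<lambda>\<omega>. samples_until k (\<lambda>i. Z i \<omega>))) g"
    by (rule integral_distr[symmetric]) auto
  then show ?E by (simp add: D)
qed

text \<open>Independence passes to the squares, so the first and second moments of the product both
  factor.\<close>

lemma variance_mult_indep:
  fixes A B :: "'a \<Rightarrow> real"
  assumes "indep_var borel A borel B"
    and "integrable M A" "integrable M B"
    and "integrable M (\<lambda>\<omega>. (A \<omega>)\<^sup>2)" "integrable M (\<lambda>\<omega>. (B \<omega>)\<^sup>2)"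
  shows "variance (\<lambda>\<omega>. A \<omega> * B \<omega>) =
    expectation (\<lambda>\<omega>. (A \<omega>)\<^sup>2) * expectation (\<lambda>\<omega>. (B \<omega>)\<^sup>2) - (expectation A * expectation B)\<^sup>2"
proof -
  have "indep_var borel ((\<lambda>x. x\<^sup>2) \<circ> A) borel ((\<lambda>x. x\<^sup>2) \<circ> B)"
    by (rule indep_var_compose[OF assms(1)]) auto
  then have ind2: "indep_var borel (\<lambda>\<omega>. (A \<omega>)\<^sup>2) borel (\<lambda>\<omega>. (B \<omega>)\<^sup>2)"
    by (simp add: comp_def)
  show ?thesis
    using indep_var_lebesgue_integral[OF assms(1,2,3)] indep_var_integrable[OF assms(1,2,3)]
      indep_var_lebesgue_integral[OF ind2 assms(4,5)] indep_var_integrable[OF ind2 assms(4,5)]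
    by (subst variance_eq) (simp_all add: power_mult_distrib)
qed

end

section \<open>Efficiency of the odds estimator\<close>

theorem mainTheorem3:
  fixes M :: "'a measure" and X Y :: "nat \<Rightarrow> 'a \<Rightarrow> bool" and r :: nat and p :: real
    and N1 N2 N :: "'a \<Rightarrow> nat" and gamma_hat :: "'a \<Rightarrow> real"
  assumes "prob_space M"
    and "r \<ge> 2" and "0 < p" and "p < 1"
    and "prob_space.iid_bernoulli M p X"
    and "prob_space.iid_bernoulli M p Y"
    and "prob_space.independent_sequences M X Y"
    and "N1 = (\<lambda>\<omega>. samples_until (r + 1) (\<lambda>i. X i \<omega>))"
    and "N2 = (\<lambda>\<omega>. samples_until (r - 1) (\<lambda>i. \<not> Y i \<omega>))"
    and "gamma_hat = (\<lambda>\<omega>. real r / (real (N1 \<omega>) - 1) * (real (N2 \<omega>) / (real r - 1)))"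
    and "N = (\<lambda>\<omega>. N1 \<omega> + N2 \<omega>)"
  shows "prob_space.efficiency M (\<lambda>q. q / (1 - q)) p gamma_hat N =
           p / ((1 - p) ^ 3 * prob_space.variance M gamma_hat
                  * prob_space.expectation M (\<lambda>\<omega>. real (N \<omega>)))
       \<and> prob_space.efficiency M (\<lambda>q. q / (1 - q)) p gamma_hat N >
           (real r - 1) / (real r + 1 - 2 * p) * (1 + p * (1 - p) / (real r - 1 + p + p\<^sup>2))
       \<and> (real r - 1) / (real r + 1 - 2 * p) * (1 + p * (1 - p) / (real r - 1 + p + p\<^sup>2)) >
           (real r - 1) / (real r + 1)"
proof -
  interpret prob_space M by fact
  define k where "k = r - 1"
  define q where "q = 1 - p"
  have k: "0 < k" "r = Suc k" and rk: "real r - 1 = real k" using \<open>r \<ge> 2\<close> by (auto simp: k_def)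
  have p: "0 < p" "p < 1" and q: "0 < q" "q < 1" "q \<le> 1" using assms(3,4) by (auto simp: q_def)
  have X: "iid_bernoulli p X" by fact
  have Y: "iid_bernoulli q (\<lambda>i \<omega>. \<not> Y i \<omega>)"
    unfolding q_def by (rule iid_bernoulli_Not) (use assms in auto)
  have N1: "N1 = (\<lambda>\<omega>. samples_until (Suc r) (\<lambda>i. X i \<omega>))"
    and N2: "N2 = (\<lambda>\<omega>. samples_until k (\<lambda>i. \<not> Y i \<omega>))"
    using assms(8,9) by (simp_all add: k_def)
  have tX: "integrable M (\<lambda>\<omega>. g (N1 \<omega>)) \<longleftrightarrow>
      integrable (measure_pmf (neg_binomial_pmf (Suc r) p)) (\<lambda>j. g (Suc r + j))"
    "expectation (\<lambda>\<omega>. g (N1 \<omega>)) = measure_pmf.expectation (neg_binomial_pmf (Suc r) p) (\<lambda>j. g (Suc r + j))"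
    for g :: "nat \<Rightarrow> real"
    using samples_until_transfer[OF X, of "Suc r" g] p by (auto simp: N1)
  have tY: "integrable M (\<lambda>\<omega>. g (N2 \<omega>)) \<longleftrightarrow>
      integrable (measure_pmf (neg_binomial_pmf k q)) (\<lambda>j. g (k + j))"
    "expectation (\<lambda>\<omega>. g (N2 \<omega>)) = measure_pmf.expectation (neg_binomial_pmf k q) (\<lambda>j. g (k + j))"
    for g :: "nat \<Rightarrow> real"
    using samples_until_transfer[OF Y, of k g] q k by (auto simp: N2)
  \<comment> \<open>\<open>A\<close> is Haldane's estimator of \<open>p\<close> from
    \<open>X\<close>, and \<open>B\<close> is an unbiased estimator of \<open>1 / q\<close> from
    \<open>Y\<close>.\<close>
  define A where "A \<omega> = real r / (real (N1 \<omega>) - 1)" for \<omega>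
  define B where "B \<omega> = real (N2 \<omega>) / real k" for \<omega>
  have gamma: "gamma_hat = (\<lambda>\<omega>. A \<omega> * B \<omega>)"
    using assms(10) by (simp add: A_def B_def rk fun_eq_iff)

  \<comment> \<open>\<open>A\<close> and \<open>B\<close> are measurable functions of the two
    independent sequences; the negation of \<open>Y\<close> is absorbed into the second
    function.\<close>
  have ind: "indep_var borel A borel B"
  proof -
    have "indep_var borel ((\<lambda>S. real r / (real (samples_until (Suc r) S) - 1)) \<circ> (\<lambda>\<omega> i. X i \<omega>))
        borel ((\<lambda>S. real (samples_until k (\<lambda>i. \<not> S i)) / real k) \<circ> (\<lambda>\<omega> i. Y i \<omega>))"
    proof (rule indep_var_compose)
      show "indep_var (\<Pi>\<^sub>M i\<in>UNIV. count_space UNIV) (\<lambda>\<omega> i. X i \<omega>)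
          (\<Pi>\<^sub>M i\<in>UNIV. count_space UNIV) (\<lambda>\<omega> i. Y i \<omega>)"
        using assms(7) by (simp add: independent_sequences_def)
      have "(\<lambda>S i. \<not> S i) \<in> (\<Pi>\<^sub>M i\<in>UNIV. count_space UNIV) \<rightarrow>\<^sub>M (\<Pi>\<^sub>M i\<in>(UNIV :: nat set). count_space UNIV)"
        by (rule measurable_PiM_single') auto
      note [measurable] = measurable_compose[OF this measurable_samples_until]
      show "(\<lambda>S. real (samples_until k (\<lambda>i. \<not> S i)) / real k)
          \<in> borel_measurable (\<Pi>\<^sub>M i\<in>UNIV. count_space UNIV)"
        by measurable
    qed measurable
    then show ?thesis
      by (simp add: comp_def A_def[abs_def] B_def[abs_def] N1 N2)
  qed

  \<comment> \<open>\<open>N1\<close> is distributed as \<open>Suc r + J\<close>, so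
    \<open>N1 - 1\<close> corresponds to \<open>r + J\<close> with \<open>J\<close> of order
    \<open>Suc r\<close>.\<close>
  have A1: "expectation A = p"
    unfolding A_def[abs_def] tX(2)[of "\<lambda>n. real r / (real n - 1)"]
    using expectation_neg_binomial_pmf_haldane[of p r] p k by simp
  have A2: "expectation (\<lambda>\<omega>. (A \<omega>)\<^sup>2) < p\<^sup>2 * (real r + p) / (real k + 2 * p)"
    unfolding A_def[abs_def] tX(2)[of "\<lambda>n. (real r / (real n - 1))\<^sup>2"]
    using expectation_neg_binomial_pmf_haldane_square_less[of p r] p k by simp
  have bdd: "\<bar>real r / (real (Suc r + j) - 1)\<bar> \<le> 1" for j
    using k by simp
  have intA: "integrable M A"
    unfolding A_def[abs_def] tX(1)[of "\<lambda>n. real r / (real n - 1)"]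
    by (rule measure_pmf.integrable_const_bound[where B = 1]) (use bdd in auto)
  have intA2: "integrable M (\<lambda>\<omega>. (A \<omega>)\<^sup>2)"
    unfolding A_def[abs_def] tX(1)[of "\<lambda>n. (real r / (real n - 1))\<^sup>2"]
    by (rule measure_pmf.integrable_const_bound[where B = 1])
      (use bdd in \<open>auto simp: abs_square_le_1 simp del: of_nat_add\<close>)

  have intN2: "integrable M (\<lambda>\<omega>. real (N2 \<omega>))" and EN2: "expectation (\<lambda>\<omega>. real (N2 \<omega>)) = real k / q"
    using expectation_neg_binomial_pmf_trials[OF q(1,3) k(1)] tY[of real] by simp_all
  have intN2': "integrable M (\<lambda>\<omega>. (real (N2 \<omega>))\<^sup>2)"
    and EN2': "expectation (\<lambda>\<omega>. (real (N2 \<omega>))\<^sup>2) = real k * (real k + 1 - q) / q\<^sup>2"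
    using expectation_neg_binomial_pmf_trials_square[OF q(1,3) k(1)] tY[of "\<lambda>n. (real n)\<^sup>2"]
    by simp_all
  have B1: "expectation B = 1 / q" and intB: "integrable M B"
    using intN2 EN2 k by (simp_all add: B_def[abs_def])
  have B2: "expectation (\<lambda>\<omega>. (B \<omega>)\<^sup>2) = (real k + p) / (real k * q\<^sup>2)"
    and intB2: "integrable M (\<lambda>\<omega>. (B \<omega>)\<^sup>2)"
    using intN2' EN2' k by (simp_all add: B_def[abs_def] power_divide q_def power2_eq_square)

  have intN1: "integrable M (\<lambda>\<omega>. real (N1 \<omega>))"
    and EN1: "expectation (\<lambda>\<omega>. real (N1 \<omega>)) = real (Suc r) / p"
    using expectation_neg_binomial_pmf_trials[of p "Suc r"] tX[of real] p by simp_all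
  \<comment> \<open>Over the denominator \<open>p * q\<close> the numerator
    \<open>(r + 1) * q + (r - 1) * p\<close> collapses to \<open>r + 1 - 2 * p\<close>.\<close>
  have EN: "expectation (\<lambda>\<omega>. real (N \<omega>)) = (real r + 1 - 2 * p) / (p * q)"
  proof -
    have "expectation (\<lambda>\<omega>. real (N \<omega>)) = real (Suc r) / p + real k / q"
      by (simp add: assms(11) intN1 intN2 EN1 EN2 del: of_nat_Suc)
    then show ?thesis using p q k by (simp add: q_def field_simps)
  qed

  define a where "a = expectation (\<lambda>\<omega>. (A \<omega>)\<^sup>2)"
  \<comment> \<open>Nonnegativity of the variance of \<open>A\<close> bounds its second moment from
    below, which yields positivity of the variance of \<open>gamma_hat\<close>.\<close>
  have "a = variance A + p\<^sup>2"
    using variance_eq[OF intA intA2] by (simp add: a_def A1)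
  then have a: "p\<^sup>2 \<le> a" by (simp add: integral_nonneg)
  have V: "variance gamma_hat = a * ((real k + p) / (real k * q\<^sup>2)) - (p / q)\<^sup>2"
    unfolding gamma variance_mult_indep[OF ind intA intB intA2 intB2] A1 B1 B2 a_def by simp
  have Vpos: "variance gamma_hat > 0"
  proof -
    \<comment> \<open>Strictness comes from \<open>B\<close>: its second moment exceeds
      \<open>1 / q\<^sup>2\<close> by the factor \<open>(k + p) / k > 1\<close>.\<close>
    have "(p / q)\<^sup>2 < p\<^sup>2 * ((real k + p) / (real k * q\<^sup>2))"
      using p q k by (simp add: power_divide field_simps)
    also have "\<dots> \<le> a * ((real k + p) / (real k * q\<^sup>2))"
      using a p q k by (intro mult_right_mono) auto
    finally show ?thesis unfolding V by simp
  qed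
  \<comment> \<open>The value of the variance formula when the second moment of \<open>A\<close> is
    replaced by its upper bound.\<close>
  define U where "U = p\<^sup>2 / q\<^sup>2 * (real r - 1 + p + p\<^sup>2) / (real k * (real k + 2 * p))"
  have VU: "variance gamma_hat < U"
  proof -
    have "variance gamma_hat <
        p\<^sup>2 * (real r + p) / (real k + 2 * p) * ((real k + p) / (real k * q\<^sup>2)) - (p / q)\<^sup>2"
      unfolding V a_def using A2 p q k by (intro diff_strict_right_mono mult_strict_right_mono) auto
    also have "\<dots> = U"
    proof -
      have "(real r + p) * (real k + p) - real k * (real k + 2 * p) = real r - 1 + p + p\<^sup>2"
        by (simp add: k(2) power2_eq_square algebra_simps)
      then have "U = p\<^sup>2 / q\<^sup>2 * ((real r + p) * (real k + p) - real k * (real k + 2 * p)) /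
          (real k * (real k + 2 * p))" by (simp add: U_def)
      also have "\<dots> = p\<^sup>2 * (real r + p) / (real k + 2 * p) * ((real k + p) / (real k * q\<^sup>2)) - (p / q)\<^sup>2"
        using p q k(1) by (simp add: power_divide diff_divide_distrib right_diff_distrib add_pos_pos mult_ac)
      finally show ?thesis by simp
    qed
    finally show ?thesis .
  qed

  have "deriv (\<lambda>q. q / (1 - q)) p = 1 / (1 - p)\<^sup>2"
    by (rule DERIV_imp_deriv)
      (use p in \<open>auto intro!: derivative_eq_intros simp: power2_eq_square\<close>)
  moreover have "(1 / u\<^sup>2)\<^sup>2 * p * u = p / u ^ 3" for u :: real
    by (cases "u = 0") (simp_all add: field_simps power2_eq_square power3_eq_cube)
  ultimately have "(deriv (\<lambda>q. q / (1 - q)) p)\<^sup>2 * p * (1 - p) = p / (1 - p) ^ 3"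
    by simp
  then have eff: "efficiency (\<lambda>q. q / (1 - q)) p gamma_hat N =
      p / ((1 - p) ^ 3 * variance gamma_hat * expectation (\<lambda>\<omega>. real (N \<omega>)))"
    unfolding efficiency_def by (simp add: mult.assoc)

  have w: "real r + 1 - 2 * p > 0" "real k + 2 * p > 0" "real r - 1 + p + p\<^sup>2 > 0"
    using p k by (auto simp: add_pos_pos)
  \<comment> \<open>The claimed lower bound is exactly the efficiency with \<open>U\<close> in place
    of the variance, so the strict estimate \<open>VU\<close> decides the comparison.\<close>
  have "(real r - 1) / (real r + 1 - 2 * p) * (1 + p * (1 - p) / (real r - 1 + p + p\<^sup>2)) =
      p / (q ^ 3 * U * expectation (\<lambda>\<omega>. real (N \<omega>)))"
  proof -
    have "1 + p * (1 - p) / (real r - 1 + p + p\<^sup>2) = (real k + 2 * p) / (real r - 1 + p + p\<^sup>2)"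
      using w by (simp add: rk field_simps power2_eq_square)
    then show ?thesis
      using p q w k by (simp add: EN U_def rk power2_eq_square power3_eq_cube)
  qed
  also have "\<dots> < p / (q ^ 3 * variance gamma_hat * expectation (\<lambda>\<omega>. real (N \<omega>)))"
  proof (rule divide_strict_left_mono)
    have E: "expectation (\<lambda>\<omega>. real (N \<omega>)) > 0" unfolding EN using w p q by simp
    show "q ^ 3 * variance gamma_hat * expectation (\<lambda>\<omega>. real (N \<omega>)) <
        q ^ 3 * U * expectation (\<lambda>\<omega>. real (N \<omega>))"
      using VU E q by simp
    show "0 < q ^ 3 * U * expectation (\<lambda>\<omega>. real (N \<omega>)) *
        (q ^ 3 * variance gamma_hat * expectation (\<lambda>\<omega>. real (N \<omega>)))"
      using Vpos VU E q by (intro mult_pos_pos) auto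
  qed fact
  finally have lower: "efficiency (\<lambda>q. q / (1 - q)) p gamma_hat N >
      (real r - 1) / (real r + 1 - 2 * p) * (1 + p * (1 - p) / (real r - 1 + p + p\<^sup>2))"
    by (simp add: eff q_def)

  \<comment> \<open>The denominator \<open>r + 1 - 2 * p\<close> is strictly smaller than
    \<open>r + 1\<close>, and the correction factor is at least 1.\<close>
  have "(real r - 1) / (real r + 1) < (real r - 1) / (real r + 1 - 2 * p) * 1"
    unfolding mult_1_right using w p k rk by (intro divide_strict_left_mono) auto
  also have "\<dots> \<le> (real r - 1) / (real r + 1 - 2 * p) * (1 + p * (1 - p) / (real r - 1 + p + p\<^sup>2))"
    using w p k rk by (intro mult_left_mono) auto
  finally show ?thesis using eff lower by blast
qed

end
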